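(* Let $G$ and $G'$ be graphs on the same vertex set with $G'\subseteq G$, and let $s_1,s_2,\ell$ be positive integers such that for every set $S$ of vertices the following hold: (i) if $|S|<s_1+s_2+\ell$, then $|E(G[S])|<2s_2$; (ii) if $|S|=s_1$, then $|N_{G'}(S)|\ge s_2+\ell$. If $|V(G)|\ge \ell+s_1+s_2$, then $G'$ contains a path of length $\ell$ which is an induced path in $G$.
   Context: For a graph $H$ and a vertex set $S$, $N_H(S)$ denotes the external neighbourhood of $S$ in $H$: the set of vertices not in $S$ that have at least one neighbour (in $H$) in $S$. $G[S]$ is the subgraph of $G$ induced by $S$. The length of a path is its number of edges; a path is induced in $G$ if it is an induced subgraph of $G$. *)

theory Defs
  imports Main
begin

datatype 'a graph = Graph (verts: "'a set") (edges: "'a set set")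

definition finite_simple_graph :: "'a graph \<Rightarrow> bool" where
  "finite_simple_graph G \<longleftrightarrow>
     finite (verts G) \<and> (\<forall>e\<in>edges G. e \<subseteq> verts G \<and> card e = 2)"

definition subgraph :: "'a graph \<Rightarrow> 'a graph \<Rightarrow> bool" where
  "subgraph H G \<longleftrightarrow> verts H \<subseteq> verts G \<and> edges H \<subseteq> edges G"

definition induced_by :: "'a graph \<Rightarrow> 'a set \<Rightarrow> 'a graph" where
  "induced_by G S = Graph S {e \<in> edges G. e \<subseteq> S}"

definition induced_subgraph :: "'a graph \<Rightarrow> 'a graph \<Rightarrow> bool" where
  "induced_subgraph H G \<longleftrightarrow> verts H \<subseteq> verts G \<and> H = induced_by G (verts H)"

definition ext_neighbourhood :: "'a graph \<Rightarrow> 'a set \<Rightarrow> 'a set" where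
  "ext_neighbourhood H S = {v \<in> verts H. v \<notin> S \<and> (\<exists>u\<in>S. {u, v} \<in> edges H)}"

text \<open>A path is a graph in its own right. Its length is its number of edges, so a path of
  length \<open>l\<close> has \<open>l + 1\<close> vertices.\<close>

definition path_of_length :: "nat \<Rightarrow> 'a graph \<Rightarrow> bool" where
  "path_of_length l P \<longleftrightarrow>
     (\<exists>xs. distinct xs \<and> length xs = l + 1 \<and>
           P = Graph (set xs) {{xs ! i, xs ! (i + 1)} | i. i < l})"

end

theory Submission
  imports Defs
begin

text \<open>Depth-first search in \<open>G'\<close>, keeping the stack an induced path of \<open>G\<close>. A neighbour of the top
  of the stack that has a second \<open>G\<close>-neighbour on the stack is discarded, and each discarded vertex
  brings two new edges into \<open>G\<close> restricted to the visited vertices, so by (i) fewer than \<open>s2\<close> vertices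
  are discarded while fewer than \<open>s1\<close> have been popped. All \<open>G'\<close>-neighbours of a popped
  vertex are visited, so when the \<open>s1\<close>-th vertex is popped, the neighbourhood of the popped set
  lies in the discarded set together with the stack, and (ii) fails unless the stack has at some
  moment contained more than \<open>l\<close> vertices.\<close>

section \<open>Induced paths as vertex lists\<close>

text \<open>Path edges come from \<open>E'\<close>, while the forbidden chords are taken from
  \<open>E\<close>. Recursion on the head matches pushing and popping at the top of the stack, and
  the empty list counts because the stack may run empty.\<close>

fun induced_path :: "'a set set \<Rightarrow> 'a set set \<Rightarrow> 'a list \<Rightarrow> bool" where
  "induced_path E E' [] \<longleftrightarrow> True"
| "induced_path E E' [v] \<longleftrightarrow> True"
| "induced_path E E' (v # u # xs) \<longleftrightarrow>
     induced_path E E' (u # xs) \<and> v \<notin> set (u # xs) \<and> {v, u} \<in> E' \<and> (\<forall>w\<in>set xs. {v, w} \<notin> E)"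

lemma induced_path_distinct: "induced_path E E' xs \<Longrightarrow> distinct xs"
  by (induction E E' xs rule: induced_path.induct) auto

lemma induced_path_tl: "induced_path E E' (v # xs) \<Longrightarrow> induced_path E E' xs"
  by (cases xs) auto

lemma consecutive_pairs_Cons:
  "{{(v # u # xs) ! i, (v # u # xs) ! (i + 1)} | i. i < length (u # xs)} =
   insert {v, u} {{(u # xs) ! i, (u # xs) ! (i + 1)} | i. i < length xs}" (is "?L = ?R")
proof
  show "?L \<subseteq> ?R"
  proof
    fix e assume "e \<in> ?L"
    then obtain i where "i < length (u # xs)" "e = {(v # u # xs) ! i, (v # u # xs) ! (i + 1)}"
      by blast
    then show "e \<in> ?R" by (cases i) auto
  qed
  show "?R \<subseteq> ?L"
  proof
    fix e assume "e \<in> ?R"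
    then consider "e = {v, u}"
      | i where "i < length xs" "e = {(u # xs) ! i, (u # xs) ! (i + 1)}" by blast
    then show "e \<in> ?L"
    proof cases
      case 1
      then show ?thesis by (intro CollectI exI[of _ 0]) simp
    next
      case 2
      then show ?thesis by (intro CollectI exI[of _ "Suc i"]) simp
    qed
  qed
qed

text \<open>By induction on the list: an edge of \<open>E\<close> inside the list that contains the
  head \<open>v\<close> has exactly one other end, and the chord condition leaves only
  \<open>u\<close> for it.\<close>

lemma induced_path_edges:
  assumes "induced_path E E' xs" "xs \<noteq> []" "E' \<subseteq> E" "\<And>e. e \<in> E \<Longrightarrow> card e = 2"
  shows "{{xs ! i, xs ! (i + 1)} | i. i < length xs - 1} = {e \<in> E. e \<subseteq> set xs}"
    and "{{xs ! i, xs ! (i + 1)} | i. i < length xs - 1} \<subseteq> E'"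
proof -
  have "{{xs ! i, xs ! (i + 1)} | i. i < length xs - 1} = {e \<in> E. e \<subseteq> set xs} \<and>
      {{xs ! i, xs ! (i + 1)} | i. i < length xs - 1} \<subseteq> E'"
    using assms
  proof (induction E E' xs rule: induced_path.induct)
    case (1 E E')
    then show ?case by simp
  next
    case (2 E E' v)
    have "e \<notin> E" if "e \<subseteq> {v}" for e
      using 2(4)[of e] that by (auto simp: subset_singleton_iff)
    then show ?case by auto
  next
    case (3 E E' v u xs)
    let ?P = "{{(u # xs) ! i, (u # xs) ! (i + 1)} | i. i < length xs}"
    have IH: "?P = {e \<in> E. e \<subseteq> set (u # xs)}" "?P \<subseteq> E'"
      using "3.IH" "3.prems" by auto
    have vu: "{v, u} \<in> E'" "{v, u} \<in> E" using "3.prems" by auto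
    have "e \<subseteq> set (u # xs) \<or> e = {v, u}" if e: "e \<in> E" "e \<subseteq> set (v # u # xs)" for e
    proof (cases "v \<in> e")
      case True
      obtain w where w: "e = {v, w}" "w \<noteq> v"
        using "3.prems"(4)[OF e(1)] True by (auto simp: card_2_iff doubleton_eq_iff)
      then have "w = u" using e "3.prems"(1) by auto
      with w show ?thesis by simp
    next
      case False
      then show ?thesis using e by auto
    qed
    then have "{e \<in> E. e \<subseteq> set (v # u # xs)} = insert {v, u} {e \<in> E. e \<subseteq> set (u # xs)}"
      using vu by auto
    moreover have "{{(v # u # xs) ! i, (v # u # xs) ! (i + 1)} | i. i < length (v # u # xs) - 1} =
        insert {v, u} ?P"
      using consecutive_pairs_Cons[of v u xs] by simp
    ultimately show ?case using IH vu by simp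
  qed
  then show "{{xs ! i, xs ! (i + 1)} | i. i < length xs - 1} = {e \<in> E. e \<subseteq> set xs}"
    and "{{xs ! i, xs ! (i + 1)} | i. i < length xs - 1} \<subseteq> E'" by auto
qed

lemma induced_path_graph:
  assumes "finite_simple_graph G" "subgraph G' G" "verts G' = verts G"
    and "induced_path (edges G) (edges G') xs" "set xs \<subseteq> verts G" "length xs = l + 1"
  shows "\<exists>P. path_of_length l P \<and> subgraph P G' \<and> induced_subgraph P G"
proof -
  let ?D = "{{xs ! i, xs ! (i + 1)} | i. i < l}"
  have "xs \<noteq> []" "edges G' \<subseteq> edges G" "\<And>e. e \<in> edges G \<Longrightarrow> card e = 2"
    using assms by (auto simp: subgraph_def finite_simple_graph_def)
  note D = induced_path_edges[OF assms(4) this]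
  have "?D = {e \<in> edges G. e \<subseteq> set xs}" "?D \<subseteq> edges G'"
    using D assms(6) by simp_all
  moreover have "path_of_length l (Graph (set xs) ?D)"
    unfolding path_of_length_def using induced_path_distinct[OF assms(4)] assms(6) by blast
  ultimately show ?thesis
    using assms(3,5)
    by (intro exI[of _ "Graph (set xs) ?D"])
      (simp add: subgraph_def induced_subgraph_def induced_by_def)
qed

section \<open>Search states and the three moves of the search\<close>

text \<open>\<open>A\<close> holds the popped vertices, \<open>B\<close> the discarded ones; the top of the stack is the
  head of \<open>xs\<close>.\<close>

definition dfs_state ::
    "'a set \<Rightarrow> 'a set set \<Rightarrow> 'a set set \<Rightarrow> 'a set \<Rightarrow> 'a set \<Rightarrow> 'a list \<Rightarrow> bool" where
  "dfs_state V E E' A B xs \<longleftrightarrow>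
     A \<subseteq> V \<and> B \<subseteq> V \<and> set xs \<subseteq> V \<and> A \<inter> B = {} \<and> A \<inter> set xs = {} \<and> B \<inter> set xs = {} \<and>
     induced_path E E' xs \<and>
     (\<forall>a\<in>A. \<forall>v\<in>V. {a, v} \<in> E' \<longrightarrow> v \<in> A \<union> B \<union> set xs) \<and>
     2 * card B \<le> card {e \<in> E. e \<subseteq> A \<union> B \<union> set xs}"

lemma dfs_state_push:
  assumes "dfs_state V E E' A B xs" "finite E" "v \<in> V" "v \<notin> A \<union> B \<union> set xs"
    and "induced_path E E' (v # xs)"
  shows "dfs_state V E E' A B (v # xs)"
proof -
  have "card {e \<in> E. e \<subseteq> A \<union> B \<union> set xs} \<le> card {e \<in> E. e \<subseteq> A \<union> B \<union> set (v # xs)}"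
    using assms(2) by (intro card_mono) auto
  then show ?thesis using assms unfolding dfs_state_def by auto
qed

text \<open>The visited set \<open>A \<union> B \<union> set xs\<close> does not change, so the edge
  count and the closure of the vertices popped earlier carry over. Closure at \<open>u\<close> is
  the second assumption.\<close>

lemma dfs_state_pop:
  assumes "dfs_state V E E' A B (u # xs)"
    and "\<And>v. v \<in> V \<Longrightarrow> {u, v} \<in> E' \<Longrightarrow> v \<in> A \<union> B \<union> set (u # xs)"
  shows "dfs_state V E E' (insert u A) B xs"
proof -
  have "u \<notin> set xs" "induced_path E E' xs"
    using assms(1) induced_path_distinct[of E E' "u # xs"] induced_path_tl[of E E' u xs]
    unfolding dfs_state_def by auto
  moreover have "insert u A \<union> B \<union> set xs = A \<union> B \<union> set (u # xs)" by auto
  ultimately show ?thesis using assms unfolding dfs_state_def by auto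
qed

text \<open>The edges from \<open>v\<close> to \<open>u\<close> and to \<open>w\<close> are
  distinct, since \<open>u\<close> lies outside the rest of the stack, and new, since
  \<open>v\<close> was unvisited. They pay for the growth of \<open>2 * card B\<close> by 2.\<close>

lemma dfs_state_discard:
  assumes "dfs_state V E E' A B (u # xs)" "finite E" "finite V"
    and "v \<in> V" "v \<notin> A \<union> B \<union> set (u # xs)" "{v, u} \<in> E" "w \<in> set xs" "{v, w} \<in> E"
  shows "dfs_state V E E' A (insert v B) (u # xs)"
proof -
  let ?F = "{e \<in> E. e \<subseteq> A \<union> B \<union> set (u # xs)}"
  have "u \<noteq> w"
    using assms(1,7) induced_path_distinct[of E E' "u # xs"] unfolding dfs_state_def by auto
  then have ne: "{v, u} \<noteq> {v, w}" by (auto simp: doubleton_eq_iff)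
  have new: "{v, u} \<notin> ?F" "{v, w} \<notin> ?F" using assms(5) by auto
  have "finite ?F" using assms(2) by simp
  have "card (insert {v, u} (insert {v, w} ?F)) = card ?F + 2"
    using ne new \<open>finite ?F\<close> by simp
  moreover have "card (insert {v, u} (insert {v, w} ?F)) \<le>
      card {e \<in> E. e \<subseteq> A \<union> insert v B \<union> set (u # xs)}"
    using assms by (intro card_mono) auto
  moreover have "2 * card (insert v B) = 2 * card B + 2"
    using assms finite_subset[of B V] unfolding dfs_state_def by simp
  moreover have "2 * card B \<le> card ?F" using assms(1) unfolding dfs_state_def by blast
  ultimately have "2 * card (insert v B) \<le> card {e \<in> E. e \<subseteq> A \<union> insert v B \<union> set (u # xs)}"
    by linarith
  then show ?thesis using assms unfolding dfs_state_def by auto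
qed

section \<open>A maximal search state and its contradiction with (i) and (ii)\<close>

theorem theorem2p1:
  fixes G G' :: "'a graph" and s1 s2 l :: nat
  assumes "finite_simple_graph G" and "finite_simple_graph G'"
    and "verts G' = verts G" and "subgraph G' G"
    and "s1 > 0" and "s2 > 0" and "l > 0"
    and "\<And>S. S \<subseteq> verts G \<Longrightarrow> card S < s1 + s2 + l \<Longrightarrow> card (edges (induced_by G S)) < 2 * s2"
    and "\<And>S. S \<subseteq> verts G \<Longrightarrow> card S = s1 \<Longrightarrow> card (ext_neighbourhood G' S) \<ge> s2 + l"
    and "card (verts G) \<ge> l + s1 + s2"
  shows "\<exists>P. path_of_length l P \<and> subgraph P G' \<and> induced_subgraph P G"
proof (rule ccontr)
  assume no_path: "\<nexists>P. path_of_length l P \<and> subgraph P G' \<and> induced_subgraph P G"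
  let ?V = "verts G" and ?E = "edges G" and ?E' = "edges G'"
  let ?st = "dfs_state ?V ?E ?E'"
  have finV: "finite ?V" using assms(1) by (simp add: finite_simple_graph_def)
  have "?E \<subseteq> Pow ?V" using assms(1) by (auto simp: finite_simple_graph_def)
  then have finE: "finite ?E" using finV finite_subset by blast
  have sub: "?E' \<subseteq> ?E" using assms(4) by (simp add: subgraph_def)
  \<comment> \<open>The stack grows one vertex at a time, so excluding length \<open>l + 1\<close>
    keeps it at length at most \<open>l\<close>.\<close>
  have short: "length xs \<noteq> l + 1" if "?st A B xs" for A B xs
    using that no_path induced_path_graph[OF assms(1,4,3)] unfolding dfs_state_def by blast
  have card_visited: "card (A \<union> B \<union> set xs) \<le> card A + card B + length xs"
    for A B :: "'a set" and xs
    using card_Un_le[of "A \<union> B" "set xs"] card_Un_le[of A B] card_length[of xs] by linarith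
  define Q where "Q = (\<lambda>(A, B, xs). ?st A B xs \<and> card A < s1 \<and> card B < s2 \<and> length xs \<le> l)"
  \<comment> \<open>Every move increases \<open>m\<close>: a push by 1, a discard by 2, and a pop by
    2 - 1 = 1, which is why \<open>card A\<close> has weight 2. A state maximising \<open>m\<close>
    thus replaces running the search to its end.\<close>
  define m :: "'a set \<times> 'a set \<times> 'a list \<Rightarrow> nat" where
    "m = (\<lambda>(A, B, xs). 2 * card A + 2 * card B + length xs)"
  have "Q ({}, {}, [])"
    using assms(5,6) by (simp add: Q_def dfs_state_def)
  moreover have "\<forall>t. Q t \<longrightarrow> m t < 2 * s1 + 2 * s2 + l"
    by (auto simp: Q_def m_def)
  ultimately obtain t where t: "Q t" "\<And>t'. Q t' \<Longrightarrow> m t' \<le> m t"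
    using ex_has_greatest_nat[of Q "({}, {}, [])" m "2 * s1 + 2 * s2 + l"] by (metis less_imp_le)
  obtain A B xs where t_eq: "t = (A, B, xs)" by (cases t)
  have st: "?st A B xs" and cA: "card A < s1" and cB: "card B < s2" and len: "length xs \<le> l"
    using t(1) by (auto simp: Q_def t_eq)
  have max: "\<not> Q (A', B', ys)"
    if "2 * card A + 2 * card B + length xs < 2 * card A' + 2 * card B' + length ys" for A' B' ys
    using t(2)[of "(A', B', ys)"] that by (auto simp: m_def t_eq)
  have AB: "finite A" "finite B" "A \<subseteq> ?V" "B \<subseteq> ?V" "set xs \<subseteq> ?V" "A \<inter> set xs = {}"
    using st finV finite_subset unfolding dfs_state_def by blast+
  have no_push: "\<not> induced_path ?E ?E' (v # xs)" if "v \<in> ?V" "v \<notin> A \<union> B \<union> set xs" for v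
  proof
    assume "induced_path ?E ?E' (v # xs)"
    then have st': "?st A B (v # xs)" using dfs_state_push[OF st finE that] by blast
    then have "length (v # xs) \<le> l" using short[OF st'] len by simp
    then have "Q (A, B, v # xs)" using st' cA cB by (simp add: Q_def)
    then show False using max[of A B "v # xs"] by simp
  qed
  show False
  proof (cases xs)
    case Nil
    \<comment> \<open>With an empty stack any unvisited vertex can be pushed, as a single vertex is
      an induced path; one exists because fewer than \<open>s1 + s2 + l\<close> vertices are
      visited.\<close>
    have "card (A \<union> B \<union> set xs) < card ?V"
      using card_visited[of A B xs] cA cB len assms(10) by linarith
    then obtain v where "v \<in> ?V" "v \<notin> A \<union> B \<union> set xs"
      using card_mono[of "A \<union> B \<union> set xs" ?V] AB by fastforce
    then show False using no_push Nil by simp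
  next
    case (Cons u ys)
    have st: "?st A B (u # ys)" using st Cons by simp
    have "v \<in> A \<union> B \<union> set (u # ys)" if v: "v \<in> ?V" "{u, v} \<in> ?E'" for v
    proof (rule ccontr)
      assume fresh: "v \<notin> A \<union> B \<union> set (u # ys)"
      have vu: "{v, u} \<in> ?E'" using v(2) by (simp add: insert_commute)
      \<comment> \<open>As \<open>v\<close> is unvisited and joined to \<open>u\<close> in
        \<open>G'\<close>, only a chord to some \<open>w\<close> below the top can prevent the
        push.\<close>
      have "\<not> induced_path ?E ?E' (v # u # ys)" using no_push[OF v(1)] fresh Cons by simp
      moreover have "induced_path ?E ?E' (u # ys)" using st unfolding dfs_state_def by blast
      ultimately obtain w where w: "w \<in> set ys" "{v, w} \<in> ?E" using vu fresh by auto
      have st': "?st A (insert v B) (u # ys)"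
        using dfs_state_discard[OF st finE finV v(1) fresh _ w] vu sub by blast
      let ?S = "A \<union> insert v B \<union> set (u # ys)"
      have cB': "card (insert v B) = card B + 1" using fresh AB by simp
      have "?S \<subseteq> ?V" using st' unfolding dfs_state_def by blast
      \<comment> \<open>\<open>insert v B\<close> may have as many as \<open>s2\<close> elements at
        this point; the strict inequality then comes from \<open>card A < s1\<close>.\<close>
      moreover have "card ?S < s1 + s2 + l"
        using card_visited[of A "insert v B" "u # ys"] cA cB cB' len Cons by simp
      ultimately have "card {e \<in> ?E. e \<subseteq> ?S} < 2 * s2"
        using assms(8)[of ?S] by (simp add: induced_by_def)
      moreover have "2 * card (insert v B) \<le> card {e \<in> ?E. e \<subseteq> ?S}"
        using st' unfolding dfs_state_def by blast
      ultimately have "card (insert v B) < s2" by linarith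
      then have "Q (A, insert v B, u # ys)" using st' cA len Cons by (simp add: Q_def)
      then show False using max[of A "insert v B" "u # ys"] cB' Cons by simp
    qed
    then have st': "?st (insert u A) B ys" by (rule dfs_state_pop[OF st])
    have cA': "card (insert u A) = card A + 1" using AB Cons by simp
    \<comment> \<open>The pop would give a larger \<open>m\<close>, so it must violate
      \<open>Q\<close>, and the bound on \<open>card A\<close> is the only one it can break.\<close>
    have "\<not> card (insert u A) < s1"
    proof
      assume "card (insert u A) < s1"
      then have "Q (insert u A, B, ys)" using st' cB len Cons by (simp add: Q_def)
      then show False using max[of "insert u A" B ys] cA' Cons by simp
    qed
    then have "card (insert u A) = s1" using cA cA' by linarith
    moreover have "insert u A \<subseteq> ?V" using st' unfolding dfs_state_def by blast
    ultimately have "s2 + l \<le> card (ext_neighbourhood G' (insert u A))" using assms(9) by blast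
    also have "\<dots> \<le> card (B \<union> set ys)"
    proof (rule card_mono)
      show "finite (B \<union> set ys)" using AB by simp
      \<comment> \<open>Neighbours of popped vertices are visited, and external ones are not popped,
        so they are discarded or on the stack.\<close>
      show "ext_neighbourhood G' (insert u A) \<subseteq> B \<union> set ys"
        using st' assms(3) unfolding dfs_state_def ext_neighbourhood_def by blast
    qed
    also have "\<dots> \<le> card B + length ys"
      using card_Un_le[of B "set ys"] card_length[of ys] by linarith
    \<comment> \<open>Both \<open>card B\<close> is below \<open>s2\<close> and, after the pop,
      \<open>length ys\<close> is below \<open>l\<close>.\<close>
    also have "\<dots> < s2 + l" using cB len Cons by simp
    finally show False by simp
  qed
qed

end
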